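(* Let $t$ be a positive integer, let $k,n,p$ be integers with $n=k+p$ and $2\le p\le k-2$, and let $G\in{\rm Cri}_t(k,n)$. If $G$ has no $t$-dominating subgraph belonging to ${\rm Cri}_t(1)\cup{\rm Cri}_t(2)$, then $e(G)\ge t\binom{n}{2}-tp^2$.
   Context: All graphs are finite, undirected, loopless, and may have multiple edges; $e(G)$ is the number of edges of $G$ (with multiplicity). A graph is strictly $t$-degenerate if every non-empty subgraph $H$ has a vertex of degree at most $t-1$ in $H$. $\chi_t(G)$ is the least $k\ge0$ such that $V(G)$ can be colored with $k$ colors so that each color class induces a strictly $t$-degenerate subgraph. $G$ is $\chi_t$-critical if $\chi_t(G')<\chi_t(G)$ for every proper subgraph $G'$; ${\rm Cri}_t(k)$ is the class of $\chi_t$-critical graphs with $\chi_t=k$, and ${\rm Cri}_t(k,n)$ those of order $n$. For disjoint graphs $G_1,G_2$, the Dirac $t$-join $G_1\boxplus^tG_2$ is obtained from $G_1\cup G_2$ by adding, for all $u\in V(G_1)$, $v\in V(G_2)$, exactly $t$ parallel edges between $u$ and $v$. A non-empty subgraph $H$ of $G$ is $t$-dominating if there is a non-empty subgraph $G'$ of $G$ with $G=H\boxplus^t G'$. *)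

theory Defs
  imports "HOL-Library.Multiset"
begin

text \<open>
  A multigraph is a vertex set together with a multiset of edges, each edge being the
  set of its two end-vertices. Parallel edges are repeated elements of the multiset.
\<close>

datatype 'a mgraph = MGraph (verts: "'a set") (edges: "'a set multiset")

definition multigraph :: "'a mgraph \<Rightarrow> bool" where
  "multigraph G \<longleftrightarrow> finite (verts G) \<and> (\<forall>e \<in># edges G. e \<subseteq> verts G \<and> card e = 2)"

definition num_edges :: "'a mgraph \<Rightarrow> nat" where
  "num_edges G = size (edges G)"

definition degree :: "'a mgraph \<Rightarrow> 'a \<Rightarrow> nat" where
  "degree G v = size {#e \<in># edges G. v \<in> e#}"

definition subgraph :: "'a mgraph \<Rightarrow> 'a mgraph \<Rightarrow> bool" where
  "subgraph H G \<longleftrightarrow> multigraph H \<and> verts H \<subseteq> verts G \<and> edges H \<subseteq># edges G"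

definition proper_subgraph :: "'a mgraph \<Rightarrow> 'a mgraph \<Rightarrow> bool" where
  "proper_subgraph H G \<longleftrightarrow> subgraph H G \<and> H \<noteq> G"

definition induced_subgraph :: "'a mgraph \<Rightarrow> 'a set \<Rightarrow> 'a mgraph" where
  "induced_subgraph G X = MGraph (verts G \<inter> X) {#e \<in># edges G. e \<subseteq> X#}"

text \<open>
  For \<open>t \<ge> 1\<close> the condition \<open>degree H v < t\<close> says that the degree is at most \<open>t - 1\<close>.
  The empty graph is strictly \<open>t\<close>-degenerate.
\<close>

definition strictly_degenerate :: "nat \<Rightarrow> 'a mgraph \<Rightarrow> bool" where
  "strictly_degenerate t G \<longleftrightarrow>
     (\<forall>H. subgraph H G \<and> verts H \<noteq> {} \<longrightarrow> (\<exists>v \<in> verts H. degree H v < t))"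

definition t_colorable :: "nat \<Rightarrow> 'a mgraph \<Rightarrow> nat \<Rightarrow> bool" where
  "t_colorable t G k \<longleftrightarrow>
     (\<exists>c :: 'a \<Rightarrow> nat. (\<forall>v \<in> verts G. c v < k) \<and>
        (\<forall>i < k. strictly_degenerate t (induced_subgraph G {v \<in> verts G. c v = i})))"

text \<open>
  For a multigraph and \<open>t \<ge> 1\<close> the minimum exists: give every vertex its own color.
\<close>

definition chi :: "nat \<Rightarrow> 'a mgraph \<Rightarrow> nat" where
  "chi t G = (LEAST k. t_colorable t G k)"

definition chi_critical :: "nat \<Rightarrow> 'a mgraph \<Rightarrow> bool" where
  "chi_critical t G \<longleftrightarrow> multigraph G \<and> (\<forall>G'. proper_subgraph G' G \<longrightarrow> chi t G' < chi t G)"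

definition Cri :: "nat \<Rightarrow> nat \<Rightarrow> 'a mgraph set" where
  "Cri t k = {G. chi_critical t G \<and> chi t G = k}"

definition Cri_order :: "nat \<Rightarrow> nat \<Rightarrow> nat \<Rightarrow> 'a mgraph set" where
  "Cri_order t k n = {G \<in> Cri t k. card (verts G) = n}"

text \<open>The join is meaningful only for graphs with disjoint vertex sets.\<close>

definition dirac_join :: "nat \<Rightarrow> 'a mgraph \<Rightarrow> 'a mgraph \<Rightarrow> 'a mgraph" where
  "dirac_join t G1 G2 =
     MGraph (verts G1 \<union> verts G2)
       (edges G1 + edges G2 +
        repeat_mset t (image_mset (\<lambda>(u, v). {u, v}) (mset_set (verts G1 \<times> verts G2))))"

definition t_dominating :: "nat \<Rightarrow> 'a mgraph \<Rightarrow> 'a mgraph \<Rightarrow> bool" where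
  "t_dominating t H G \<longleftrightarrow>
     subgraph H G \<and> verts H \<noteq> {} \<and>
     (\<exists>G'. subgraph G' G \<and> verts G' \<noteq> {} \<and> verts H \<inter> verts G' = {} \<and> G = dirac_join t H G')"

end

(*
  Colorings into strictly t-degenerate classes only depend on the hereditary system of vertex
  sets X with G[X] strictly t-degenerate. If a vertex-critical system has n <= 2k - 2, then an
  optimal coloring has two singleton classes. Let P be an optimal coloring with as few singleton
  classes as possible, fix a singleton y of P, and let A be the set of vertices that are
  singletons together with y in some such coloring. An exchange argument shows that no pair
  {a, b} with a in A, b outside A is a face, that is, a and b are joined by at least t edges.
  By criticality G is then the Dirac t-join of G[A] and G - A, both again critical, and the
  t-chromatic numbers add up.

  Put p = n - k and d = t n (n - 1) - 2 e(G). Both p and d are additive under the join. A graph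
  with n >= 2k - 1 satisfies d <= t (2 p^2 + p), because all degrees are at least t (k - 1). If
  a join has p = p1 + p2 with p1, p2 >= 1 (this is where the parts with k <= 2 are excluded),
  then 2 p1^2 + p1 + 2 p2^2 + p2 <= 2 p^2, so d <= 2 t p^2 by induction.
*)

theory Submission
  imports Defs
begin

section \<open>Vertex-critical set systems of small order\<close>

text \<open>The number of colors is kept out of the definition and measured by the image of
  \<open>V\<close>, so classes can be merged or moved without renumbering.\<close>

definition face_coloring :: "('a set \<Rightarrow> bool) \<Rightarrow> 'a set \<Rightarrow> ('a \<Rightarrow> 'b) \<Rightarrow> bool" where
  "face_coloring F V f \<longleftrightarrow> (\<forall>i. F {v \<in> V. f v = i})"

definition singles :: "'a set \<Rightarrow> ('a \<Rightarrow> 'b) \<Rightarrow> 'a set" where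
  "singles V f = {v \<in> V. \<forall>u \<in> V. f u = f v \<longleftrightarrow> u = v}"

lemma singles_iff: "v \<in> singles V f \<Longrightarrow> u \<in> V \<Longrightarrow> f u = f v \<longleftrightarrow> u = v"
  by (simp add: singles_def)

lemma singles_in: "v \<in> singles V f \<Longrightarrow> v \<in> V"
  by (simp add: singles_def)

text \<open>Each class contributes its size plus the number of its singletons, which is at least 2:
  one plus one for a singleton class, at least two vertices otherwise.\<close>

lemma two_colors_le_card_plus_singles:
  assumes "finite V"
  shows "2 * card (f ` V) \<le> card V + card (singles V f)"
proof -
  let ?C = "\<lambda>i. {v \<in> V. f v = i}"
  have disj: "i \<noteq> j \<Longrightarrow> ?C i \<inter> ?C j = {}" for i j by auto
  have V: "card V = (\<Sum>i \<in> f ` V. card (?C i))"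
    using assms by (subst card_UN_disjoint[symmetric]) (auto intro: arg_cong[where f=card])
  have S: "card (singles V f) = (\<Sum>i \<in> f ` V. card (?C i \<inter> singles V f))"
    using assms by (subst card_UN_disjoint[symmetric]) (auto simp: singles_def intro!: arg_cong[where f=card])
  have "2 \<le> card (?C i) + card (?C i \<inter> singles V f)" if "i \<in> f ` V" for i
  proof -
    from that obtain v where v: "v \<in> V" "f v = i" by auto
    show ?thesis
    proof (cases "v \<in> singles V f")
      case True
      then have "?C i = {v}" using v singles_iff[of v V f] by auto
      moreover from this have "?C i \<inter> singles V f = {v}" using True by blast
      ultimately show ?thesis by simp
    next
      case False
      then obtain u where "u \<in> V" "f u = i" "u \<noteq> v" using v by (auto simp: singles_def)
      then have "card {u, v} \<le> card (?C i)" using v assms by (intro card_mono) auto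
      then show ?thesis using \<open>u \<noteq> v\<close> by simp
    qed
  qed
  then have "(\<Sum>i \<in> f ` V. 2) \<le> (\<Sum>i \<in> f ` V. card (?C i) + card (?C i \<inter> singles V f))"
    by (intro sum_mono) auto
  then show ?thesis unfolding V S by (simp add: sum.distrib)
qed

text \<open>This is what the exchange argument uses of strict degeneracy. \<open>colors_ge\<close>
  and \<open>critical\<close> make \<open>k\<close> the least number of colors and let every vertex
  be alone in its class in some optimal coloring; \<open>small_order\<close> forces two singleton
  classes.\<close>

locale vertex_critical_faces =
  fixes F :: "'a set \<Rightarrow> bool" and V :: "'a set" and k :: nat
  assumes finite_V: "finite V"
    and nonempty_V: "V \<noteq> {}"
    and face_mono: "X \<subseteq> Y \<Longrightarrow> F Y \<Longrightarrow> F X"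
    and colors_ge: "face_coloring F V (f :: 'a \<Rightarrow> nat) \<Longrightarrow> k \<le> card (f ` V)"
    and critical: "v \<in> V \<Longrightarrow>
      \<exists>f :: 'a \<Rightarrow> nat. face_coloring F V f \<and> card (f ` V) = k \<and> v \<in> singles V f"
    and small_order: "card V + 2 \<le> 2 * k"
begin

section \<open>Optimal colorings and the exchange argument\<close>

definition optimal :: "('a \<Rightarrow> nat) \<Rightarrow> bool" where
  "optimal f \<longleftrightarrow> face_coloring F V f \<and> card (f ` V) = k"

lemma optimal_face: "optimal f \<Longrightarrow> F {v \<in> V. f v = i}"
  by (simp add: optimal_def face_coloring_def)

text \<open>By minimality of \<open>k\<close>, a coloring that stays within the palette of an
  optimal one uses all of it. Contradictions below come from a color that a recoloring has
  lost.\<close>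

lemma optimal_no_fewer:
  assumes "optimal f" "face_coloring F V g" "g ` V \<subseteq> f ` V"
  shows "optimal g" "g ` V = f ` V"
proof -
  have "card (g ` V) \<le> card (f ` V)" using assms finite_V by (intro card_mono) auto
  then have c: "card (g ` V) = card (f ` V)"
    using colors_ge[OF assms(2)] assms(1) by (auto simp: optimal_def)
  then show "optimal g" using assms(1,2) by (simp add: optimal_def)
  show "g ` V = f ` V" by (rule card_subset_eq[OF _ assms(3) c]) (simp add: finite_V)
qed

text \<open>If the pair were a face, its two singleton classes could be merged, which frees the
  color of \<open>y\<close>.\<close>

lemma singles_not_face:
  assumes "optimal f" "x \<in> singles V f" "y \<in> singles V f" "x \<noteq> y"
  shows "\<not> F {x, y}"
proof
  assume xy: "F {x, y}"
  define g where "g = f(y := f x)"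
  have V: "x \<in> V" "y \<in> V" by (rule singles_in, fact assms)+
  have "F {v \<in> V. g v = i}" for i
  proof (cases "i = f x")
    case True
    have "{v \<in> V. g v = i} \<subseteq> {x, y}"
      using True singles_iff[OF assms(2)] by (auto simp: g_def split: if_splits)
    then show ?thesis using xy by (rule face_mono)
  next
    case False
    have "{v \<in> V. g v = i} \<subseteq> {v \<in> V. f v = i}" using False by (auto simp: g_def)
    then show ?thesis using optimal_face[OF assms(1)] by (rule face_mono)
  qed
  then have fc: "face_coloring F V g" by (simp add: face_coloring_def)
  have "g ` V \<subseteq> f ` V" using V by (auto simp: g_def)
  then have "g ` V = f ` V" using optimal_no_fewer[OF assms(1) fc] by simp
  moreover have "g u \<noteq> f y" if "u \<in> V" for u
    using singles_iff[OF assms(3) that] singles_iff[OF assms(3) V(1)] assms(4) by (simp add: g_def)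
  ultimately show False using V by force
qed

text \<open>Its size is the potential of an extremal choice. Recording pairs of vertices makes it
  independent of the names of the colors.\<close>

definition agreement :: "('a \<Rightarrow> nat) \<Rightarrow> ('a \<Rightarrow> nat) \<Rightarrow> ('a \<times> 'a) set" where
  "agreement P Q = {(a, b) \<in> V \<times> V. P a = P b \<and> Q a = Q b}"

text \<open>
  Moving those vertices of the \<open>Q\<close>-class of \<open>z'\<close> that are in the \<open>P\<close>-class of \<open>z\<close> into the
  singleton class \<open>{z}\<close> of \<open>Q\<close> keeps both classes faces. If the class of \<open>z'\<close> were \<open>{w}\<close>, this
  would save a color.
\<close>
lemma increase_agreement:
  assumes P: "optimal P" and Q: "optimal Q" and w: "w \<in> singles V Q"
    and z: "z \<in> singles V Q" "z \<noteq> w" "z \<notin> singles V P"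
  shows "\<exists>R. optimal R \<and> w \<in> singles V R \<and> agreement P Q \<subset> agreement P R"
proof -
  have V: "z \<in> V" "w \<in> V" by (rule singles_in, fact z w)+
  obtain z' where z': "z' \<in> V" "P z' = P z" "z' \<noteq> z" using z(3) V by (auto simp: singles_def)
  have Qz: "\<And>u. u \<in> V \<Longrightarrow> Q u = Q z \<longleftrightarrow> u = z" and Qw: "\<And>u. u \<in> V \<Longrightarrow> Q u = Q w \<longleftrightarrow> u = w"
    using singles_iff[OF z(1)] singles_iff[OF w] by auto
  define R where "R = (\<lambda>v. if P v = P z \<and> Q v = Q z' then Q z else Q v)"
  have "F {v \<in> V. R v = i}" for i
  proof (cases "i = Q z")
    case True
    have "{v \<in> V. R v = i} \<subseteq> {v \<in> V. P v = P z}" using True Qz by (auto simp: R_def split: if_splits)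
    then show ?thesis using optimal_face[OF P] by (rule face_mono)
  next
    case False
    have "{v \<in> V. R v = i} \<subseteq> {v \<in> V. Q v = i}" using False by (auto simp: R_def split: if_splits)
    then show ?thesis using optimal_face[OF Q] by (rule face_mono)
  qed
  then have fc: "face_coloring F V R" by (simp add: face_coloring_def)
  have "R ` V \<subseteq> Q ` V" using V by (auto simp: R_def)
  note R = optimal_no_fewer[OF Q fc this]
  have zw': "z' \<noteq> w"
  proof
    assume "z' = w"
    then have "R u \<noteq> Q w" if "u \<in> V" for u
      using that Qw[OF that] Qw[of z] V z(2) z'(2) by (auto simp: R_def)
    then have "Q w \<notin> R ` V" by force
    then show False using R(2) V by auto
  qed
  have "Q z' \<noteq> Q w" using Qw z' zw' by auto
  then have "R u = R w \<longleftrightarrow> u = w" if "u \<in> V" for u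
    using that Qw[OF that] Qw[of z] V z by (auto simp: R_def)
  then have "w \<in> singles V R" using V by (auto simp: singles_def)
  \<comment> \<open>The color in \<open>R\<close> depends only on the colors in \<open>P\<close> and
    \<open>Q\<close>, so no agreeing pair is separated. The pair \<open>(z, z')\<close> is
    gained.\<close>
  moreover have "agreement P Q \<subseteq> agreement P R" by (auto simp: agreement_def R_def)
  moreover have "(z, z') \<in> agreement P R" using V z' by (auto simp: agreement_def R_def)
  moreover have "(z, z') \<notin> agreement P Q" using z' Qz[of z'] by (auto simp: agreement_def)
  ultimately show ?thesis using R(1) by blast
qed

text \<open>Among the optimal colorings with \<open>w\<close> alone, take one that agrees most with
  \<open>P\<close>. A further singleton that is not a singleton of \<open>P\<close> would allow the
  agreement to grow.\<close>

lemma exists_aligned_coloring: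
  assumes P: "optimal P" and w: "w \<in> V"
  shows "\<exists>Q. optimal Q \<and> w \<in> singles V Q \<and> singles V Q \<subseteq> insert w (singles V P)"
proof -
  obtain Q where Q: "optimal Q \<and> w \<in> singles V Q"
      "\<And>R. optimal R \<and> w \<in> singles V R \<Longrightarrow> card (agreement P R) \<le> card (agreement P Q)"
  proof -
    have "\<exists>Q. optimal Q \<and> w \<in> singles V Q" using critical[OF w] by (auto simp: optimal_def)
    moreover have "card (agreement P R) \<le> card (V \<times> V)" for R
      using finite_V by (intro card_mono) (auto simp: agreement_def)
    ultimately show ?thesis
      using ex_has_greatest_nat[of "\<lambda>Q. optimal Q \<and> w \<in> singles V Q" _ "\<lambda>R. card (agreement P R)"
          "Suc (card (V \<times> V))"] that by (auto simp: less_Suc_eq_le)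
  qed
  have "z \<in> singles V P" if z: "z \<in> singles V Q" "z \<noteq> w" for z
  proof (rule ccontr)
    assume "z \<notin> singles V P"
    then obtain R where R: "optimal R" "w \<in> singles V R" "agreement P Q \<subset> agreement P R"
      using increase_agreement[of P Q w z] P Q(1) z by auto
    have "finite (agreement P R)"
      by (rule finite_subset[of _ "V \<times> V"]) (use finite_V in \<open>auto simp: agreement_def\<close>)
    then have "card (agreement P Q) < card (agreement P R)" using R(3) by (intro psubset_card_mono)
    then show False using Q(2)[of R] R by auto
  qed
  then show ?thesis using Q(1) by blast
qed

text \<open>Were \<open>{a, b}\<close> a face across the partition, then from a coloring in which
  \<open>a\<close> and \<open>y\<close> are alone one could trade the singleton \<open>a\<close> for
  the singleton \<open>b\<close> while keeping \<open>y\<close>, and \<open>b\<close> would belong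
  to \<open>A\<close>.\<close>

theorem no_face_across_partition:
  obtains A where "A \<subseteq> V" "A \<noteq> {}" "V - A \<noteq> {}"
    "\<forall>a \<in> A. \<forall>b \<in> V - A. \<not> F {a, b}"
proof -
  obtain f where "optimal f" using critical nonempty_V by (auto simp: optimal_def)
  then obtain P where P: "optimal P"
      "\<And>Q. optimal Q \<Longrightarrow> card (singles V P) \<le> card (singles V Q)"
    using ex_has_least_nat[of optimal f "\<lambda>Q. card (singles V Q)"] by blast
  have fin: "finite (singles V f)" for f :: "'a \<Rightarrow> nat" using finite_V by (auto simp: singles_def)
  \<comment> \<open>With s singletons, 2k \<le> n + s and n \<le> 2k - 2 give s \<ge> 2.\<close>
  have "2 \<le> card (singles V P)"
    using two_colors_le_card_plus_singles[OF finite_V, of P] small_order P(1) by (auto simp: optimal_def)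
  then obtain x y where xy: "x \<in> singles V P" "y \<in> singles V P" "x \<noteq> y"
    using card_le_Suc0_iff_eq[OF fin, of P] by force
  define minimal where
    "minimal Q \<longleftrightarrow> optimal Q \<and> card (singles V Q) = card (singles V P)" for Q
  \<comment> \<open>Excluding \<open>y\<close> puts it on the other side, so the complement of
    \<open>A\<close> is nonempty.\<close>
  define A where "A = {u. u \<noteq> y \<and> (\<exists>Q. minimal Q \<and> u \<in> singles V Q \<and> y \<in> singles V Q)}"
  have A: "\<not> F {a, b}" if a: "a \<in> A" and b: "b \<in> V - A" for a b
  proof
    assume ab: "F {a, b}"
    obtain Q where Q: "minimal Q" "a \<in> singles V Q" "y \<in> singles V Q" "a \<noteq> y"
      using a by (auto simp: A_def)
    have oQ: "optimal Q" using Q by (simp add: minimal_def)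
    have "b \<noteq> y" using singles_not_face[OF oQ Q(2,3,4)] ab by auto
    have "b \<noteq> a" using a b by auto
    then have bQ: "b \<notin> singles V Q" using singles_not_face[OF oQ Q(2), of b] ab by auto
    obtain R where R: "optimal R" "b \<in> singles V R" "singles V R \<subseteq> insert b (singles V Q)"
      using exists_aligned_coloring[OF oQ, of b] b by auto
    \<comment> \<open>\<open>b\<close> is alone in \<open>R\<close>, so the face
      \<open>{a, b}\<close> prevents \<open>a\<close> from being alone as well.\<close>
    have "a \<notin> singles V R" using singles_not_face[OF R(1) R(2), of a] ab \<open>b \<noteq> a\<close>
      by (auto simp: insert_commute)
    then have sub: "singles V R \<subseteq> insert b (singles V Q - {a})" using R(3) by auto
    have card: "card (insert b (singles V Q - {a})) = card (singles V P)"
    proof -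
      have "card (insert b (singles V Q - {a})) = Suc (card (singles V Q - {a}))"
        using fin[of Q] bQ by (subst card_insert_disjoint) auto
      also have "\<dots> = card (singles V Q)" using fin Q(2) by (simp only: card_Suc_Diff1)
      finally show ?thesis using Q(1) by (simp add: minimal_def)
    qed
    \<comment> \<open>The right side has exactly the minimum number of singletons, so the inclusion
      is an equality; hence \<open>y\<close> stays a singleton.\<close>
    have "singles V R = insert b (singles V Q - {a})"
      using P(2)[OF R(1)] card sub fin[of Q] by (intro card_seteq) simp_all
    then have "minimal R" "y \<in> singles V R" using R(1) card Q by (simp_all add: minimal_def)
    then have "b \<in> A" using R(2) \<open>b \<noteq> y\<close> unfolding A_def by blast
    then show False using b by auto
  qed
  have "x \<in> A" using xy P(1) unfolding A_def minimal_def by blast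
  moreover have "y \<in> V - A" using xy by (simp add: A_def singles_def)
  moreover have "A \<subseteq> V" by (auto simp: A_def singles_def)
  ultimately show ?thesis using A by (intro that[of A]) auto
qed

end


section \<open>Strict degeneracy and colorings\<close>

lemma subgraph_trans: "subgraph H K \<Longrightarrow> subgraph K G \<Longrightarrow> subgraph H G"
  unfolding subgraph_def using subset_mset.order_trans by blast

lemma subgraph_refl: "multigraph G \<Longrightarrow> subgraph G G"
  by (simp add: subgraph_def)

lemma multigraph_induced_subgraph: "multigraph G \<Longrightarrow> multigraph (induced_subgraph G X)"
  by (auto simp: multigraph_def induced_subgraph_def)

lemma verts_induced_subgraph [simp]: "verts (induced_subgraph G X) = verts G \<inter> X"
  by (simp add: induced_subgraph_def)

lemma induced_induced_subgraph:
  "X \<subseteq> Y \<Longrightarrow> induced_subgraph (induced_subgraph G Y) X = induced_subgraph G X"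
  by (auto simp: induced_subgraph_def filter_filter_mset intro!: filter_mset_cong)

lemma induced_subgraph_subgraph:
  assumes "multigraph G"
  shows "subgraph (induced_subgraph G X) G"
  using multigraph_induced_subgraph[OF assms] by (auto simp: subgraph_def induced_subgraph_def)

lemma induced_subgraph_mono:
  assumes "subgraph H G" "X \<subseteq> Y"
  shows "subgraph (induced_subgraph H X) (induced_subgraph G Y)"
proof -
  have "filter_mset (\<lambda>e. e \<subseteq> X) (edges H) \<subseteq># filter_mset (\<lambda>e. e \<subseteq> Y) (edges H)"
    using assms(2) by (induction "edges H") (auto intro: filter_mset_mono_strong)
  also have "\<dots> \<subseteq># filter_mset (\<lambda>e. e \<subseteq> Y) (edges G)"
    using assms(1) by (intro multiset_filter_mono) (simp add: subgraph_def)
  finally show ?thesis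
    using assms multigraph_induced_subgraph[of H X]
    by (auto simp: subgraph_def induced_subgraph_def)
qed

lemma strictly_degenerate_subgraph:
  "strictly_degenerate t G \<Longrightarrow> subgraph H G \<Longrightarrow> strictly_degenerate t H"
  unfolding strictly_degenerate_def using subgraph_trans by blast

lemma strictly_degenerate_no_verts: "verts G = {} \<Longrightarrow> strictly_degenerate t G"
  by (auto simp: strictly_degenerate_def subgraph_def)

lemma degree_le_num_edges: "degree G v \<le> num_edges G"
  by (simp add: degree_def num_edges_def size_filter_mset_lesseq)

lemma num_edges_subgraph: "subgraph H G \<Longrightarrow> num_edges H \<le> num_edges G"
  by (simp add: num_edges_def subgraph_def size_mset_mono)

lemma degree_subgraph: "subgraph H G \<Longrightarrow> degree H v \<le> degree G v"
  unfolding degree_def subgraph_def by (intro size_mset_mono multiset_filter_mono) auto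

lemma strictly_degenerate_few_edges:
  assumes "num_edges G < t"
  shows "strictly_degenerate t G"
  unfolding strictly_degenerate_def
proof (intro allI impI)
  fix H assume H: "subgraph H G \<and> verts H \<noteq> {}"
  then obtain v where "v \<in> verts H" by blast
  moreover have "degree H v < t"
    using degree_le_num_edges[of H v] num_edges_subgraph[of H G] H assms by linarith
  ultimately show "\<exists>v \<in> verts H. degree H v < t" ..
qed

lemma num_edges_induced_pair:
  assumes "multigraph G" "a \<noteq> b"
  shows "num_edges (induced_subgraph G {a, b}) = count (edges G) {a, b}"
proof -
  have "e \<subseteq> {a, b} \<longleftrightarrow> e = {a, b}" if "e \<in># edges G" for e
  proof
    assume "e \<subseteq> {a, b}"
    moreover have "card e = 2" using that assms by (auto simp: multigraph_def)
    ultimately show "e = {a, b}" using assms(2) by (intro card_subset_eq) auto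
  qed auto
  then have "filter_mset (\<lambda>e. e \<subseteq> {a, b}) (edges G) = filter_mset (\<lambda>e. e = {a, b}) (edges G)"
    by (intro filter_mset_cong) auto
  then show ?thesis by (simp add: num_edges_def induced_subgraph_def filter_eq_replicate_mset)
qed

text \<open>This translates two-element faces into edge multiplicities. In the subgraph that carries
  all parallel edges of the pair, both ends have the multiplicity as their degree.\<close>

lemma strictly_degenerate_pair_iff:
  assumes "multigraph G" "a \<noteq> b" "a \<in> verts G" "b \<in> verts G"
  shows "strictly_degenerate t (induced_subgraph G {a, b}) \<longleftrightarrow> count (edges G) {a, b} < t"
proof
  assume "count (edges G) {a, b} < t"
  then show "strictly_degenerate t (induced_subgraph G {a, b})"
    using assms by (intro strictly_degenerate_few_edges) (simp add: num_edges_induced_pair)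
next
  let ?H = "MGraph {a, b} (replicate_mset (count (edges G) {a, b}) {a, b})"
  assume sd: "strictly_degenerate t (induced_subgraph G {a, b})"
  have "count (edges ?H) e \<le> count (edges (induced_subgraph G {a, b})) e" for e
    by (auto simp: induced_subgraph_def)
  then have "edges ?H \<subseteq># edges (induced_subgraph G {a, b})" by (intro mset_subset_eqI)
  then have "subgraph ?H (induced_subgraph G {a, b})"
    using assms by (auto simp: subgraph_def multigraph_def)
  then obtain v where v: "v \<in> {a, b}" "degree ?H v < t"
    using sd by (fastforce simp: strictly_degenerate_def)
  have "filter_mset (\<lambda>e. v \<in> e) (edges ?H) = edges ?H"
    using v(1) by (auto simp: filter_mset_eq_conv)
  then have "degree ?H v = count (edges G) {a, b}" unfolding degree_def by simp
  then show "count (edges G) {a, b} < t" using v by simp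
qed

text \<open>A subgraph containing \<open>v\<close> has \<open>v\<close> as a vertex of small degree;
  one avoiding \<open>v\<close> already lies in the graph induced by \<open>X\<close>.\<close>

lemma strictly_degenerate_insert:
  assumes "strictly_degenerate t (induced_subgraph G X)"
    and "degree (induced_subgraph G (insert v X)) v < t"
  shows "strictly_degenerate t (induced_subgraph G (insert v X))"
  unfolding strictly_degenerate_def
proof (intro allI impI)
  fix H assume H: "subgraph H (induced_subgraph G (insert v X)) \<and> verts H \<noteq> {}"
  show "\<exists>u \<in> verts H. degree H u < t"
  proof (cases "v \<in> verts H")
    case True
    moreover have "degree H v < t" using degree_subgraph[of H _ v] H assms(2) le_less_trans by blast
    ultimately show ?thesis by blast
  next
    case False
    have "multigraph H" using H by (simp add: subgraph_def)
    have "verts H \<subseteq> X" using H False by (auto simp: subgraph_def)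
    then have "e \<subseteq> X" if "e \<in># edges H" for e
      using that \<open>multigraph H\<close> by (auto simp: multigraph_def)
    then have "filter_mset (\<lambda>e. e \<subseteq> X) (edges H) = edges H"
      by (simp add: filter_mset_eq_conv)
    moreover have "filter_mset (\<lambda>e. e \<subseteq> X) (edges H) \<subseteq># filter_mset (\<lambda>e. e \<subseteq> X) (edges G)"
      using H by (intro multiset_filter_mono)
        (auto simp: subgraph_def induced_subgraph_def intro: subset_mset.order_trans)
    ultimately have "subgraph H (induced_subgraph G X)"
      using H False by (auto simp: subgraph_def induced_subgraph_def)
    then show ?thesis using assms(1) H by (auto simp: strictly_degenerate_def)
  qed
qed

section \<open>Colorings with arbitrary palettes and the t-chromatic number\<close>

definition t_coloring :: "nat \<Rightarrow> 'a mgraph \<Rightarrow> ('a \<Rightarrow> 'b) \<Rightarrow> bool" where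
  "t_coloring t G f \<longleftrightarrow> (\<forall>i. strictly_degenerate t (induced_subgraph G {v \<in> verts G. f v = i}))"

lemma t_coloring_comp_inj:
  assumes "t_coloring t G f" "inj_on g (f ` verts G)"
  shows "t_coloring t G (g \<circ> f)"
  unfolding t_coloring_def
proof
  fix i
  show "strictly_degenerate t (induced_subgraph G {v \<in> verts G. (g \<circ> f) v = i})"
  proof (cases "\<exists>u \<in> verts G. g (f u) = i")
    case True
    then obtain u where "u \<in> verts G" "g (f u) = i" by blast
    then have "{v \<in> verts G. (g \<circ> f) v = i} = {v \<in> verts G. f v = f u}"
      using assms(2) by (auto simp: inj_on_def)
    then show ?thesis using assms(1) by (simp add: t_coloring_def)
  next
    case False
    then show ?thesis by (intro strictly_degenerate_no_verts) auto
  qed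
qed

text \<open>The used colors may come from any type; numbering them from 0 gives the shape that
  \<open>t_colorable\<close> asks for.\<close>

lemma t_coloring_imp_t_colorable:
  assumes "t_coloring t G f" "finite (verts G)" "card (f ` verts G) \<le> k"
  shows "t_colorable t G k"
proof -
  obtain g where g: "bij_betw g (f ` verts G) {0..<card (f ` verts G)}"
    using assms(2) ex_bij_betw_finite_nat by blast
  then have "t_coloring t G (g \<circ> f)"
    using assms(1) by (intro t_coloring_comp_inj) (auto simp: bij_betw_def)
  moreover have "\<forall>v \<in> verts G. (g \<circ> f) v < k"
    using bij_betw_apply[OF g] assms(3) by fastforce
  ultimately show ?thesis by (auto simp: t_colorable_def t_coloring_def)
qed

text \<open>Colors from \<open>k\<close> on have empty classes, for which strict degeneracy is
  vacuous, so the condition extends to all colors.\<close>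

lemma t_colorable_imp_t_coloring:
  assumes "t_colorable t G k"
  obtains f :: "'a \<Rightarrow> nat" where "t_coloring t G f" "\<And>v. v \<in> verts G \<Longrightarrow> f v < k"
proof -
  obtain f :: "'a \<Rightarrow> nat" where f: "\<forall>v \<in> verts G. f v < k"
      "\<forall>i < k. strictly_degenerate t (induced_subgraph G {v \<in> verts G. f v = i})"
    using assms by (auto simp: t_colorable_def)
  have "strictly_degenerate t (induced_subgraph G {v \<in> verts G. f v = i})" for i
  proof (cases "i < k")
    case False
    then show ?thesis using f(1) by (intro strictly_degenerate_no_verts) auto
  qed (use f in blast)
  then have "t_coloring t G f" by (simp add: t_coloring_def)
  then show ?thesis using f(1) that by blast
qed

lemma chi_le:
  assumes "t_coloring t G f" "multigraph G"
  shows "chi t G \<le> card (f ` verts G)"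
  unfolding chi_def using assms
  by (intro Least_le t_coloring_imp_t_colorable) (auto simp: multigraph_def)

text \<open>Edges have two ends, so one-vertex classes span no edge, and 0 < t suffices. This
  coloring shows that the minimum defining \<open>chi\<close> exists.\<close>

lemma t_coloring_id:
  assumes "t \<ge> 1" "multigraph G"
  shows "t_coloring t G (\<lambda>v. v)"
proof -
  have "num_edges (induced_subgraph G {v \<in> verts G. v = i}) = 0" for i
  proof -
    have "\<not> e \<subseteq> {v \<in> verts G. v = i}" if "e \<in># edges G" for e
    proof
      assume "e \<subseteq> {v \<in> verts G. v = i}"
      then have "card e \<le> card {i}" by (intro card_mono) auto
      then show False using that assms(2) by (simp add: multigraph_def)
    qed
    then show ?thesis
      by (simp add: num_edges_def induced_subgraph_def filter_mset_eq_conv)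
  qed
  then show ?thesis
    using assms(1) by (auto simp: t_coloring_def intro: strictly_degenerate_few_edges)
qed

lemma t_colorable_chi:
  assumes "t \<ge> 1" "multigraph G"
  shows "t_colorable t G (chi t G)"
  unfolding chi_def
  using t_coloring_imp_t_colorable[OF t_coloring_id[OF assms], of "card (verts G)"] assms(2)
  by (intro LeastI) (auto simp: multigraph_def)

lemma ex_optimal_t_coloring:
  assumes "t \<ge> 1" "multigraph G"
  obtains f :: "'a \<Rightarrow> nat" where "t_coloring t G f" "card (f ` verts G) = chi t G"
proof -
  obtain f :: "'a \<Rightarrow> nat" where f: "t_coloring t G f" "\<And>v. v \<in> verts G \<Longrightarrow> f v < chi t G"
    using t_colorable_imp_t_coloring[OF t_colorable_chi[OF assms]] by blast
  have "card (f ` verts G) \<le> card {..<chi t G}" using f(2) by (intro card_mono) auto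
  then show ?thesis using that f chi_le[OF f(1) assms(2)] by simp
qed

lemma t_coloring_subgraph:
  assumes "t_coloring t G f" "subgraph H G"
  shows "t_coloring t H f"
  unfolding t_coloring_def
proof
  fix i
  have "subgraph (induced_subgraph H {v \<in> verts H. f v = i}) (induced_subgraph G {v \<in> verts G. f v = i})"
    using assms(2) by (intro induced_subgraph_mono) (auto simp: subgraph_def)
  then show "strictly_degenerate t (induced_subgraph H {v \<in> verts H. f v = i})"
    using assms(1) strictly_degenerate_subgraph by (auto simp: t_coloring_def)
qed

lemma chi_pos:
  assumes "t \<ge> 1" "multigraph G" "verts G \<noteq> {}"
  shows "1 \<le> chi t G"
proof -
  obtain f :: "'a \<Rightarrow> nat" where "card (f ` verts G) = chi t G"
    using ex_optimal_t_coloring[OF assms(1,2)] by blast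
  moreover have "card (f ` verts G) \<noteq> 0" using assms by (simp add: multigraph_def)
  ultimately show ?thesis by simp
qed

text \<open>Optimal colorings of the two parts are combined with disjoint palettes, supplied by the
  sum type; vertices in both sets follow the first coloring.\<close>

lemma chi_le_add:
  assumes "t \<ge> 1" "multigraph G" "verts G \<subseteq> A \<union> B"
  shows "chi t G \<le> chi t (induced_subgraph G A) + chi t (induced_subgraph G B)"
proof -
  let ?GA = "induced_subgraph G A" and ?GB = "induced_subgraph G B"
  obtain f :: "'a \<Rightarrow> nat" where f: "t_coloring t ?GA f" "card (f ` verts ?GA) = chi t ?GA"
    using ex_optimal_t_coloring[OF assms(1) multigraph_induced_subgraph[OF assms(2)]] by blast
  obtain g :: "'a \<Rightarrow> nat" where g: "t_coloring t ?GB g" "card (g ` verts ?GB) = chi t ?GB"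
    using ex_optimal_t_coloring[OF assms(1) multigraph_induced_subgraph[OF assms(2)]] by blast
  define h :: "'a \<Rightarrow> nat + nat" where "h v = (if v \<in> A then Inl (f v) else Inr (g v))" for v
  have ind: "strictly_degenerate t (induced_subgraph G X)"
    if "X \<subseteq> Y" "Y \<subseteq> C" "strictly_degenerate t (induced_subgraph (induced_subgraph G C) Y)" for X Y C
  proof -
    have "induced_subgraph (induced_subgraph G C) X = induced_subgraph G X"
      using that(1,2) by (intro induced_induced_subgraph) blast
    moreover have "subgraph (induced_subgraph (induced_subgraph G C) X) (induced_subgraph (induced_subgraph G C) Y)"
      using that(1) assms(2) by (intro induced_subgraph_mono subgraph_refl multigraph_induced_subgraph)
    ultimately show ?thesis using that(3) strictly_degenerate_subgraph by metis
  qed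
  have "strictly_degenerate t (induced_subgraph G {v \<in> verts G. h v = i})" for i
  proof (cases i)
    case (Inl j)
    show ?thesis
      by (rule ind[of _ "{v \<in> verts ?GA. f v = j}" A])
        (use Inl f(1) in \<open>auto simp: h_def t_coloring_def split: if_splits\<close>)
  next
    case (Inr j)
    show ?thesis
      by (rule ind[of _ "{v \<in> verts ?GB. g v = j}" B])
        (use Inr g(1) assms(3) in \<open>auto simp: h_def t_coloring_def split: if_splits\<close>)
  qed
  then have "t_coloring t G h" by (simp add: t_coloring_def)
  then have "chi t G \<le> card (h ` verts G)" using assms(2) by (rule chi_le)
  also have "\<dots> \<le> card (Inl ` f ` verts ?GA \<union> Inr ` g ` verts ?GB)"
    using assms by (intro card_mono) (auto simp: h_def multigraph_def)
  also have "\<dots> \<le> card (f ` verts ?GA) + card (g ` verts ?GB)"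
    by (rule order_trans[OF card_Un_le]) (simp add: card_image)
  finally show ?thesis using f g by simp
qed

section \<open>Dirac joins\<close>

definition cross_pairs :: "'a set \<Rightarrow> 'a set \<Rightarrow> 'a set set" where
  "cross_pairs A B = {{a, b} | a b. a \<in> A \<and> b \<in> B}"

lemma cross_pairs_commute: "cross_pairs A B = cross_pairs B A"
  unfolding cross_pairs_def by (metis (no_types, opaque_lifting) insert_commute)

lemma finite_cross_pairs: "finite A \<Longrightarrow> finite B \<Longrightarrow> finite (cross_pairs A B)"
  unfolding cross_pairs_def by (intro finite_image_set2) simp_all

lemma inj_on_pair_set:
  "A \<inter> B = {} \<Longrightarrow> inj_on (\<lambda>(u, v). {u, v}) (A \<times> B)"
  by (auto simp: inj_on_def doubleton_eq_iff)

lemma cross_pairs_image: "cross_pairs A B = (\<lambda>(u, v). {u, v}) ` (A \<times> B)"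
  by (auto simp: cross_pairs_def)

lemma card_cross_pairs: "A \<inter> B = {} \<Longrightarrow> card (cross_pairs A B) = card A * card B"
  by (simp add: cross_pairs_image card_image inj_on_pair_set card_cartesian_product)

lemma verts_dirac_join [simp]: "verts (dirac_join t G1 G2) = verts G1 \<union> verts G2"
  by (simp add: dirac_join_def)

text \<open>Disjointness makes the pairing map injective, so every cross pair is counted once before
  the repetition by \<open>t\<close>.\<close>

lemma edges_dirac_join:
  assumes "verts G1 \<inter> verts G2 = {}"
  shows "edges (dirac_join t G1 G2) =
    edges G1 + edges G2 + repeat_mset t (mset_set (cross_pairs (verts G1) (verts G2)))"
  using assms by (simp add: dirac_join_def cross_pairs_image image_mset_mset_set inj_on_pair_set)

lemma dirac_join_commute:
  assumes "verts G1 \<inter> verts G2 = {}"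
  shows "dirac_join t G1 G2 = dirac_join t G2 G1"
  using assms
  by (intro mgraph.expand)
    (auto simp: edges_dirac_join Int_commute cross_pairs_commute[of "verts G1"] ac_simps)

lemma cross_pairs_Un:
  "cross_pairs (A \<union> B) C = cross_pairs A C \<union> cross_pairs B C"
  by (auto simp: cross_pairs_def)

text \<open>Either bracketing consists of the three inner edge multisets and \<open>t\<close> copies
  of the three families of cross pairs. These families are disjoint, so unions of them become sums
  of multisets.\<close>

lemma dirac_join_assoc:
  assumes "verts G1 \<inter> verts G2 = {}" "verts G1 \<inter> verts G3 = {}" "verts G2 \<inter> verts G3 = {}"
    and "finite (verts G1)" "finite (verts G2)" "finite (verts G3)"
  shows "dirac_join t (dirac_join t G1 G2) G3 = dirac_join t G1 (dirac_join t G2 G3)"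
proof (rule mgraph.expand, intro conjI)
  let ?c = "\<lambda>G H. cross_pairs (verts G) (verts H)"
  \<comment> \<open>\<open>mset_set\<close> is empty on infinite sets, so splitting it over a union
    relies on finiteness.\<close>
  have fin: "finite (?c G1 G2)" "finite (?c G1 G3)" "finite (?c G2 G3)"
    using assms by (simp_all add: finite_cross_pairs)
  have "?c G1 G3 \<inter> ?c G2 G3 = {}" "?c G1 G2 \<inter> ?c G1 G3 = {}"
    using assms(1-3) by (auto simp: cross_pairs_def doubleton_eq_iff)
  moreover have "cross_pairs (verts G1) (verts G2 \<union> verts G3) = ?c G1 G2 \<union> ?c G1 G3"
    by (auto simp: cross_pairs_def)
  ultimately show "edges (dirac_join t (dirac_join t G1 G2) G3) = edges (dirac_join t G1 (dirac_join t G2 G3))"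
    using assms(1-3) fin
    by (simp add: edges_dirac_join Int_Un_distrib Int_Un_distrib2 cross_pairs_Un mset_set_Union
        repeat_mset_distrib_add_mset algebra_simps)
qed auto

lemma multigraph_dirac_join:
  assumes "multigraph G1" "multigraph G2" "verts G1 \<inter> verts G2 = {}"
  shows "multigraph (dirac_join t G1 G2)"
proof -
  have "e \<subseteq> verts G1 \<union> verts G2 \<and> card e = 2" if "e \<in># edges (dirac_join t G1 G2)" for e
  proof -
    have "e \<in># edges G1 \<or> e \<in># edges G2 \<or> e \<in> cross_pairs (verts G1) (verts G2)"
    proof -
      let ?C = "cross_pairs (verts G1) (verts G2)"
      have "finite ?C" using assms by (simp add: finite_cross_pairs multigraph_def)
      moreover have "e \<in># repeat_mset t M \<Longrightarrow> e \<in># M" for M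
        by (simp add: count_greater_zero_iff[symmetric] del: count_greater_zero_iff)
      ultimately have "e \<in># repeat_mset t (mset_set ?C) \<Longrightarrow> e \<in> ?C"
        by (metis elem_mset_set)
      then show ?thesis using that by (auto simp: edges_dirac_join[OF assms(3)])
    qed
    moreover have ?thesis if "e \<in> cross_pairs (verts G1) (verts G2)"
    proof -
      from that obtain a b where "e = {a, b}" "a \<in> verts G1" "b \<in> verts G2" by (auto simp: cross_pairs_def)
      moreover from this have "a \<noteq> b" using assms(3) by auto
      ultimately show ?thesis by auto
    qed
    ultimately show ?thesis using assms(1,2) by (auto simp: multigraph_def)
  qed
  then show ?thesis using assms by (simp add: multigraph_def)
qed

text \<open>Multiplicities are compared edge by edge. An edge of the join comes from only one of the
  three sources \<open>H\<close>, \<open>K\<close> and cross pairs, so each source can be checked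
  alone.\<close>

lemma dirac_join_subgraph:
  assumes G: "multigraph G" and H: "subgraph H G" and K: "subgraph K G"
    and disj: "verts H \<inter> verts K = {}"
    and cross: "\<And>a b. a \<in> verts H \<Longrightarrow> b \<in> verts K \<Longrightarrow> t \<le> count (edges G) {a, b}"
  shows "subgraph (dirac_join t H K) G"
proof -
  have mg: "multigraph H" "multigraph K" using H K by (simp_all add: subgraph_def)
  have fin: "finite (cross_pairs (verts H) (verts K))"
    using mg by (simp add: finite_cross_pairs multigraph_def)
  have "count (edges (dirac_join t H K)) e \<le> count (edges G) e" for e
  proof -
    have le: "count (edges H) e \<le> count (edges G) e" "count (edges K) e \<le> count (edges G) e"
      using H K by (auto simp: subgraph_def mset_subset_eq_count)
    \<comment> \<open>Nonemptiness matters: the empty set would lie in both disjoint vertex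
      sets.\<close>
    have eH: "e \<subseteq> verts H \<and> e \<noteq> {}" if "e \<in># edges H"
      using that mg by (auto simp: multigraph_def)
    have eK: "e \<subseteq> verts K \<and> e \<noteq> {}" if "e \<in># edges K"
      using that mg by (auto simp: multigraph_def)
    have "count (edges (dirac_join t H K)) e = count (edges H) e + count (edges K) e +
        (if e \<in> cross_pairs (verts H) (verts K) then t else 0)"
      using fin disj by (simp add: edges_dirac_join count_mset_set)
    moreover have "e \<notin># edges H \<or> e \<notin># edges K" using eH eK disj by blast
    moreover have "e \<notin># edges H \<and> e \<notin># edges K \<and> t \<le> count (edges G) e"
      if "e \<in> cross_pairs (verts H) (verts K)"
    proof -
      from that obtain a b where ab: "e = {a, b}" "a \<in> verts H" "b \<in> verts K"
        by (auto simp: cross_pairs_def)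
      then show ?thesis using cross[OF ab(2,3)] eH eK disj by blast
    qed
    ultimately show ?thesis using le by (auto simp: not_in_iff split: if_splits)
  qed
  then have "edges (dirac_join t H K) \<subseteq># edges G" by (rule mset_subset_eqI)
  then show ?thesis
    using H K multigraph_dirac_join[OF mg disj] by (auto simp: subgraph_def)
qed

section \<open>Joins, t-chromatic number and domination\<close>

lemma subgraph_dirac_join1: "multigraph G1 \<Longrightarrow> subgraph G1 (dirac_join t G1 G2)"
  by (simp add: subgraph_def dirac_join_def)

lemma subgraph_dirac_join2: "multigraph G2 \<Longrightarrow> subgraph G2 (dirac_join t G1 G2)"
  by (simp add: subgraph_def dirac_join_def)

text \<open>In an optimal coloring of \<open>G\<close>, no vertex of \<open>H\<close> shares a color
  with one of \<open>K\<close>, because \<open>t\<close> parallel edges do not fit into a class. The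
  palettes of \<open>H\<close> and \<open>K\<close> are therefore disjoint.\<close>

lemma chi_add_le:
  assumes "t \<ge> 1" and G: "multigraph G" and H: "subgraph H G" and K: "subgraph K G"
    and disj: "verts H \<inter> verts K = {}"
    and cross: "\<And>a b. a \<in> verts H \<Longrightarrow> b \<in> verts K \<Longrightarrow> t \<le> count (edges G) {a, b}"
  shows "chi t H + chi t K \<le> chi t G"
proof -
  obtain f :: "'a \<Rightarrow> nat" where f: "t_coloring t G f" "card (f ` verts G) = chi t G"
    using ex_optimal_t_coloring[OF assms(1,2)] by blast
  have fin: "finite (verts G)" using G by (simp add: multigraph_def)
  have sub: "verts H \<subseteq> verts G" "verts K \<subseteq> verts G" using H K by (auto simp: subgraph_def)
  then have fins: "finite (verts H)" "finite (verts K)" using fin finite_subset by auto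
  have "f a \<noteq> f b" if ab: "a \<in> verts H" "b \<in> verts K" for a b
  proof
    assume eq: "f a = f b"
    have V: "a \<noteq> b" "a \<in> verts G" "b \<in> verts G" using ab disj sub by auto
    have "strictly_degenerate t (induced_subgraph G {v \<in> verts G. f v = f a})"
      using f(1) by (simp add: t_coloring_def)
    moreover have "subgraph (induced_subgraph G {a, b}) (induced_subgraph G {v \<in> verts G. f v = f a})"
      using V eq by (intro induced_subgraph_mono subgraph_refl G) auto
    ultimately have "strictly_degenerate t (induced_subgraph G {a, b})"
      by (rule strictly_degenerate_subgraph)
    then show False using strictly_degenerate_pair_iff[OF G V] cross[OF ab] by simp
  qed
  then have "f ` verts H \<inter> f ` verts K = {}" by blast
  then have "card (f ` verts H) + card (f ` verts K) = card (f ` verts H \<union> f ` verts K)"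
    using fins by (simp add: card_Un_disjoint)
  also have "\<dots> \<le> card (f ` verts G)" using sub fin by (intro card_mono) auto
  finally have "card (f ` verts H) + card (f ` verts K) \<le> chi t G" using f by simp
  moreover have "chi t H \<le> card (f ` verts H)" "chi t K \<le> card (f ` verts K)"
    using H K f(1) by (auto intro!: chi_le t_coloring_subgraph[of t G] simp: subgraph_def)
  ultimately show ?thesis by linarith
qed

lemma count_dirac_join_ge:
  assumes "finite (verts G1)" "finite (verts G2)" "verts G1 \<inter> verts G2 = {}"
    and "a \<in> verts G1" "b \<in> verts G2"
  shows "t \<le> count (edges (dirac_join t G1 G2)) {a, b}"
proof -
  have "{a, b} \<in> cross_pairs (verts G1) (verts G2)" using assms by (auto simp: cross_pairs_def)
  then show ?thesis using assms by (simp add: edges_dirac_join finite_cross_pairs)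
qed

lemma chi_dirac_join_ge:
  assumes "t \<ge> 1" "multigraph H" "multigraph K" "verts H \<inter> verts K = {}"
  shows "chi t H + chi t K \<le> chi t (dirac_join t H K)"
  using assms
  by (intro chi_add_le multigraph_dirac_join subgraph_dirac_join1 subgraph_dirac_join2 count_dirac_join_ge)
    (auto simp: multigraph_def)

lemma num_edges_dirac_join:
  assumes "verts G1 \<inter> verts G2 = {}"
  shows "num_edges (dirac_join t G1 G2) =
    num_edges G1 + num_edges G2 + t * (card (verts G1) * card (verts G2))"
  using assms by (simp add: num_edges_def edges_dirac_join card_cross_pairs size_repeat_mset)

text \<open>Reassociating the two joins exhibits the new complement as the join of \<open>H'\<close>
  and \<open>K'\<close>. This passes the absence of forbidden dominating subgraphs on to the parts
  of a join.\<close>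

lemma t_dominating_trans:
  assumes "t_dominating t H K" "t_dominating t K G"
  shows "t_dominating t H G"
proof -
  obtain H' where H: "subgraph H K" "verts H \<noteq> {}" "subgraph H' K" "verts H' \<noteq> {}"
      "verts H \<inter> verts H' = {}" "K = dirac_join t H H'"
    using assms(1) by (auto simp: t_dominating_def)
  obtain K' where K: "subgraph K G" "subgraph K' G" "verts K' \<noteq> {}"
      "verts K \<inter> verts K' = {}" "G = dirac_join t K K'"
    using assms(2) by (auto simp: t_dominating_def)
  have mg: "multigraph H" "multigraph H'" "multigraph K'" using H K by (auto simp: subgraph_def)
  have disj: "verts H \<inter> verts K' = {}" "verts H' \<inter> verts K' = {}" using K(4) H(6) by auto
  have "dirac_join t (dirac_join t H H') K' = dirac_join t H (dirac_join t H' K')"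
    using disj H(5) mg by (intro dirac_join_assoc) (auto simp: multigraph_def)
  then have "G = dirac_join t H (dirac_join t H' K')" using K(5) H(6) by simp
  moreover from this have "subgraph (dirac_join t H' K') G"
    using multigraph_dirac_join[OF mg(2,3) disj(2)] subgraph_dirac_join2 by metis
  moreover have "subgraph H G" using H(1) K(1) by (rule subgraph_trans)
  ultimately show ?thesis using H disj unfolding t_dominating_def by (intro conjI exI) auto
qed

section \<open>Criticality of the parts of a join\<close>

lemma chi_critical_proper_le:
  assumes "chi_critical t G" "subgraph H G" "chi t G \<le> chi t H"
  shows "H = G"
  using assms by (force simp: chi_critical_def proper_subgraph_def)

text \<open>Suppose a proper subgraph \<open>H\<close> of \<open>G1\<close> needs as many colors as
  \<open>G1\<close>. Then its join with \<open>G2\<close> needs as many as the whole join, so by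
  criticality it is the whole join, and cancelling \<open>G2\<close> gives
  \<open>H = G1\<close>.\<close>

lemma chi_critical_part:
  assumes t: "t \<ge> 1" and mg: "multigraph G1" "multigraph G2" and disj: "verts G1 \<inter> verts G2 = {}"
    and crit: "chi_critical t (dirac_join t G1 G2)"
    and chi: "chi t (dirac_join t G1 G2) = chi t G1 + chi t G2"
  shows "chi_critical t G1"
  unfolding chi_critical_def
proof (intro conjI allI impI)
  let ?G = "dirac_join t G1 G2"
  fix H assume H: "proper_subgraph H G1"
  show "chi t H < chi t G1"
  proof (rule ccontr)
    assume "\<not> chi t H < chi t G1"
    have sub: "subgraph H G1" "verts H \<subseteq> verts G1" "multigraph H"
      using H by (auto simp: proper_subgraph_def subgraph_def)
    have disj': "verts H \<inter> verts G2 = {}" using sub disj by auto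
    have "subgraph (dirac_join t H G2) ?G"
      using mg sub disj
      by (intro dirac_join_subgraph multigraph_dirac_join subgraph_dirac_join2 disj'
          subgraph_trans[OF sub(1)] subgraph_dirac_join1 count_dirac_join_ge)
        (auto simp: multigraph_def)
    moreover have "chi t ?G \<le> chi t (dirac_join t H G2)"
      using chi chi_dirac_join_ge[OF t sub(3) mg(2) disj'] \<open>\<not> chi t H < chi t G1\<close> by linarith
    ultimately have eq: "dirac_join t H G2 = ?G" by (rule chi_critical_proper_le[OF crit])
    then have "verts H \<union> verts G2 = verts G1 \<union> verts G2" by (metis verts_dirac_join)
    then have V: "verts H = verts G1" using disj disj' by auto
    \<comment> \<open>With equal vertex sets the cross edges coincide and cancel together with the
      edges of \<open>G2\<close>.\<close>
    then have "edges H = edges G1"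
      using arg_cong[OF eq, of edges] edges_dirac_join[OF disj, of t] edges_dirac_join[OF disj', of t] by simp
    then have "H = G1" using V by (simp add: mgraph.expand)
    then show False using H by (simp add: proper_subgraph_def)
  qed
qed (fact mg)


section \<open>Critical graphs\<close>

lemma chi_delete_vertex:
  assumes "chi_critical t G" "v \<in> verts G"
  shows "chi t (induced_subgraph G (verts G - {v})) < chi t G"
proof -
  have "induced_subgraph G (verts G - {v}) \<noteq> G"
    using assms(2) by (metis verts_induced_subgraph Diff_iff IntD2 singletonI)
  then show ?thesis
    using assms induced_subgraph_subgraph by (auto simp: chi_critical_def proper_subgraph_def)
qed

text \<open>The classes are stated as induced subgraphs of \<open>G\<close> itself, ready for
  \<open>v\<close> to be put back, and the color \<open>chi t G - 1\<close> is left free.\<close>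

lemma ex_coloring_delete_vertex:
  assumes t: "t \<ge> 1" and crit: "chi_critical t G" and v: "v \<in> verts G"
  obtains f :: "'a \<Rightarrow> nat" where "\<And>u. u \<in> verts G \<Longrightarrow> u \<noteq> v \<Longrightarrow> f u < chi t G - 1"
    "\<And>i. strictly_degenerate t (induced_subgraph G {u \<in> verts G - {v}. f u = i})"
proof -
  let ?H = "induced_subgraph G (verts G - {v})"
  have "multigraph G" using crit by (simp add: chi_critical_def)
  then have "t_colorable t ?H (chi t ?H)"
    by (intro t_colorable_chi t multigraph_induced_subgraph)
  then obtain f :: "'a \<Rightarrow> nat" where f: "t_coloring t ?H f" "\<And>u. u \<in> verts ?H \<Longrightarrow> f u < chi t ?H"
    using t_colorable_imp_t_coloring by blast
  have "f u < chi t G - 1" if "u \<in> verts G" "u \<noteq> v" for u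
    using f(2)[of u] that chi_delete_vertex[OF crit v] by simp
  moreover have "strictly_degenerate t (induced_subgraph G {u \<in> verts G - {v}. f u = i})" for i
  proof -
    have "{u \<in> verts ?H. f u = i} = {u \<in> verts G - {v}. f u = i}" by auto
    then have "strictly_degenerate t (induced_subgraph ?H {u \<in> verts G - {v}. f u = i})"
      using f(1) unfolding t_coloring_def by metis
    moreover have "{u \<in> verts G - {v}. f u = i} \<subseteq> verts G - {v}" by blast
    ultimately show ?thesis by (simp only: induced_induced_subgraph)
  qed
  ultimately show ?thesis by (rule that)
qed

text \<open>Double counting of incidences between indices and edges. It serves the degree sum and
  the distribution of the edges at a vertex over color classes.\<close>

lemma size_filter_eq_sum_card:
  assumes "finite A" "\<And>e. e \<in># M \<Longrightarrow> card {i \<in> A. P i e} = m"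
  shows "(\<Sum>i\<in>A. size (filter_mset (P i) M)) = m * size M"
  using assms(2)
proof (induction M)
  case (add e M)
  have "(\<Sum>i\<in>A. size (filter_mset (P i) (add_mset e M))) =
      (\<Sum>i\<in>A. size (filter_mset (P i) M)) + (\<Sum>i\<in>A. if P i e then 1 else 0)"
    by (simp add: sum.distrib[symmetric] if_distrib cong: if_cong)
  also have "(\<Sum>i\<in>A. if P i e then 1 else 0) = card {i \<in> A. P i e}"
    using assms(1) by (simp add: sum.If_cases Int_def)
  finally show ?case using add by simp
qed simp

lemma sum_degree:
  assumes "multigraph G"
  shows "(\<Sum>v\<in>verts G. degree G v) = 2 * num_edges G"
  unfolding degree_def num_edges_def
proof (rule size_filter_eq_sum_card)
  fix e assume "e \<in># edges G"
  then have "e \<subseteq> verts G" "card e = 2" using assms by (auto simp: multigraph_def)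
  moreover from this have "{v \<in> verts G. v \<in> e} = e" by auto
  ultimately show "card {v \<in> verts G. v \<in> e} = 2" by simp
qed (use assms in \<open>simp add: multigraph_def\<close>)

text \<open>Color \<open>G\<close> without \<open>v\<close> using one color less. If the degree of
  \<open>v\<close> were smaller, some class would receive fewer than \<open>t\<close> edges from
  \<open>v\<close> and could absorb it.\<close>

lemma chi_critical_degree:
  assumes t: "t \<ge> 1" and crit: "chi_critical t G" and v: "v \<in> verts G"
  shows "t * (chi t G - 1) \<le> degree G v"
proof (rule ccontr)
  assume less: "\<not> ?thesis"
  let ?k = "chi t G - 1"
  have mg: "multigraph G" using crit by (simp add: chi_critical_def)
  obtain f :: "'a \<Rightarrow> nat" where f: "\<And>u. u \<in> verts G \<Longrightarrow> u \<noteq> v \<Longrightarrow> f u < ?k"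
      "\<And>i. strictly_degenerate t (induced_subgraph G {u \<in> verts G - {v}. f u = i})"
    using ex_coloring_delete_vertex[OF t crit v] by blast
  define C where "C i = {u \<in> verts G - {v}. f u = i}" for i
  have C: "strictly_degenerate t (induced_subgraph G (C i))" for i
    using f(2) by (simp add: C_def)
  have deg: "(\<Sum>i<?k. degree (induced_subgraph G (insert v (C i))) v) = degree G v"
  proof -
    let ?M = "filter_mset (\<lambda>e. v \<in> e) (edges G)"
    \<comment> \<open>An edge at \<open>v\<close> lies in exactly one enlarged class, that of its
      other end.\<close>
    have "card {i \<in> {..<?k}. e \<subseteq> insert v (C i)} = 1" if "e \<in># ?M" for e
    proof -
      have e: "e \<subseteq> verts G" "card e = 2" "v \<in> e" using that mg by (auto simp: multigraph_def)
      then obtain u where u: "e = {v, u}" "u \<noteq> v"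
        by (auto simp: card_2_iff)
      then have "{i \<in> {..<?k}. e \<subseteq> insert v (C i)} = {f u}"
        using f(1)[of u] e(1) by (auto simp: C_def)
      then show ?thesis by simp
    qed
    then have "(\<Sum>i<?k. size (filter_mset (\<lambda>e. e \<subseteq> insert v (C i)) ?M)) = 1 * size ?M"
      by (intro size_filter_eq_sum_card) auto
    then show ?thesis
      by (simp add: degree_def induced_subgraph_def filter_filter_mset conj_commute)
  qed
  obtain i where i: "i < ?k" "degree (induced_subgraph G (insert v (C i))) v < t"
  proof (rule ccontr)
    assume "\<not> thesis"
    then have "(\<Sum>i<?k. t) \<le> (\<Sum>i<?k. degree (induced_subgraph G (insert v (C i))) v)"
      using that by (intro sum_mono) (auto simp: not_less[symmetric])
    then show False using deg less by (simp add: mult.commute)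
  qed
  define g where "g = f(v := i)"
  have "strictly_degenerate t (induced_subgraph G {u \<in> verts G. g u = j})" for j
  proof (cases "j = i")
    case True
    then have "{u \<in> verts G. g u = j} = insert v (C i)" using v by (auto simp: g_def C_def)
    then show ?thesis using strictly_degenerate_insert[OF C i(2)] by simp
  next
    case False
    then have "{u \<in> verts G. g u = j} = C j" by (auto simp: g_def C_def)
    then show ?thesis using C by simp
  qed
  then have "t_coloring t G g" by (simp add: t_coloring_def)
  then have "chi t G \<le> card (g ` verts G)" using mg by (rule chi_le)
  also have "\<dots> \<le> card {..<?k}"
    using f(1) i(1) by (intro card_mono) (auto simp: g_def)
  \<comment> \<open>Subtraction is truncated, so the contradiction needs \<open>chi t G\<close>
    positive; this follows from \<open>i < ?k\<close>.\<close>
  finally show False using i(1) by simp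
qed

text \<open>Faces are the vertex sets inducing strictly t-degenerate subgraphs. For
  \<open>critical\<close>, delete \<open>v\<close>, color the rest with one color less and give
  \<open>v\<close> the free color.\<close>

lemma chi_critical_vertex_critical_faces:
  assumes t: "t \<ge> 1" and crit: "chi_critical t G" and ne: "verts G \<noteq> {}"
    and small: "card (verts G) + 2 \<le> 2 * chi t G"
  shows "vertex_critical_faces (\<lambda>X. strictly_degenerate t (induced_subgraph G X)) (verts G) (chi t G)"
proof
  have mg: "multigraph G" using crit by (simp add: chi_critical_def)
  show "finite (verts G)" using mg by (simp add: multigraph_def)
  show "strictly_degenerate t (induced_subgraph G X)"
    if "X \<subseteq> Y" "strictly_degenerate t (induced_subgraph G Y)" for X Y
    using strictly_degenerate_subgraph[OF that(2) induced_subgraph_mono[OF subgraph_refl[OF mg] that(1)]] .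
  have face: "face_coloring (\<lambda>X. strictly_degenerate t (induced_subgraph G X)) (verts G) f \<longleftrightarrow>
      t_coloring t G f" for f :: "'a \<Rightarrow> nat"
    by (simp add: face_coloring_def t_coloring_def)
  show ge: "chi t G \<le> card (f ` verts G)"
    if "face_coloring (\<lambda>X. strictly_degenerate t (induced_subgraph G X)) (verts G) f" for f :: "'a \<Rightarrow> nat"
    using that unfolding face by (rule chi_le[OF _ mg])
  show "\<exists>f :: 'a \<Rightarrow> nat. face_coloring (\<lambda>X. strictly_degenerate t (induced_subgraph G X)) (verts G) f \<and>
      card (f ` verts G) = chi t G \<and> v \<in> singles (verts G) f" if v: "v \<in> verts G" for v
  proof -
    let ?k = "chi t G - 1"
    have pos: "1 \<le> chi t G" by (rule chi_pos[OF t mg ne])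
    obtain f :: "'a \<Rightarrow> nat" where fk: "\<And>u. u \<in> verts G \<Longrightarrow> u \<noteq> v \<Longrightarrow> f u < ?k"
        and f: "\<And>i. strictly_degenerate t (induced_subgraph G {u \<in> verts G - {v}. f u = i})"
      using ex_coloring_delete_vertex[OF t crit v] by blast
    define g where "g = f(v := ?k)"
    have gv: "g v = ?k" by (simp add: g_def)
    have gk: "g u = ?k \<longleftrightarrow> u = v" if "u \<in> verts G" for u
      using fk[OF that] by (cases "u = v") (auto simp: g_def)
    have "strictly_degenerate t (induced_subgraph G {u \<in> verts G. g u = j})" for j
    proof (cases "j = ?k")
      case True
      then have "{u \<in> verts G. g u = j} = {u \<in> verts G. u = v}" using gk by blast
      then show ?thesis using t_coloring_id[OF t mg] by (simp add: t_coloring_def)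
    next
      case False
      then have "{u \<in> verts G. g u = j} = {u \<in> verts G - {v}. f u = j}" by (auto simp: g_def)
      then show ?thesis using f by simp
    qed
    then have g: "t_coloring t G g" by (simp add: t_coloring_def)
    have "g u < chi t G" if "u \<in> verts G" for u
      using fk[OF that] pos by (cases "u = v") (auto simp: g_def)
    then have "card (g ` verts G) \<le> card {..<chi t G}" by (intro card_mono) auto
    then have "card (g ` verts G) = chi t G" using ge[of g] face[of g] g by simp
    moreover have "v \<in> singles (verts G) g"
      using v gk by (simp add: singles_def gv)
    ultimately show ?thesis using face[of g] g by blast
  qed
qed (use ne small in auto)

text \<open>Pairs across the partition are not faces, hence carry at least \<open>t\<close> edges,
  so the join of the two induced parts sits inside \<open>G\<close>.\<close>

lemma chi_critical_decomposition:
  assumes t: "t \<ge> 1" and crit: "chi_critical t G" and ne: "verts G \<noteq> {}"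
    and small: "card (verts G) + 2 \<le> 2 * chi t G"
  obtains G1 G2 where "verts G1 \<noteq> {}" "verts G2 \<noteq> {}" "verts G1 \<inter> verts G2 = {}"
    "chi_critical t G1" "chi_critical t G2"
    "G = dirac_join t G1 G2" "chi t G = chi t G1 + chi t G2"
proof -
  have mg: "multigraph G" using crit by (simp add: chi_critical_def)
  interpret vertex_critical_faces "\<lambda>X. strictly_degenerate t (induced_subgraph G X)" "verts G" "chi t G"
    using assms by (rule chi_critical_vertex_critical_faces)
  obtain A where A: "A \<subseteq> verts G" "A \<noteq> {}" "verts G - A \<noteq> {}"
      "\<forall>a \<in> A. \<forall>b \<in> verts G - A. \<not> strictly_degenerate t (induced_subgraph G {a, b})"
    by (rule no_face_across_partition)
  define G1 where "G1 = induced_subgraph G A"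
  define G2 where "G2 = induced_subgraph G (verts G - A)"
  have V: "verts G1 = A" "verts G2 = verts G - A" using A(1) by (auto simp: G1_def G2_def)
  have disj: "verts G1 \<inter> verts G2 = {}" using V by auto
  have sub: "subgraph G1 G" "subgraph G2 G"
    unfolding G1_def G2_def by (rule induced_subgraph_subgraph[OF mg])+
  then have mgs: "multigraph G1" "multigraph G2" by (simp_all add: subgraph_def)
  have cross: "t \<le> count (edges G) {a, b}" if "a \<in> verts G1" "b \<in> verts G2" for a b
  proof -
    have "a \<noteq> b" "a \<in> verts G" "b \<in> verts G" using that V A(1) by auto
    then show ?thesis
      using strictly_degenerate_pair_iff[OF mg, of a b t] A(4) that V by simp
  qed
  have ge: "chi t G1 + chi t G2 \<le> chi t (dirac_join t G1 G2)"
    by (rule chi_dirac_join_ge[OF t mgs disj])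
  have le: "chi t G \<le> chi t G1 + chi t G2"
    unfolding G1_def G2_def by (rule chi_le_add[OF t mg]) auto
  \<comment> \<open>The join is a subgraph that needs at least as many colors as \<open>G\<close>,
    so criticality leaves no edge over.\<close>
  have "dirac_join t G1 G2 = G"
    using dirac_join_subgraph[OF mg sub disj cross] ge le
    by (intro chi_critical_proper_le[OF crit]) auto
  then have G: "G = dirac_join t G1 G2" ..
  have chi: "chi t G = chi t G1 + chi t G2" using ge le G by simp
  have "chi_critical t G1"
    using chi_critical_part[OF t mgs disj crit[unfolded G] chi[unfolded G]] .
  moreover have "chi_critical t G2"
  \<comment> \<open>The rule speaks of the left part only, so the join is commuted.\<close>
  proof (rule chi_critical_part[OF t mgs(2,1)])
    have "G = dirac_join t G2 G1" using G dirac_join_commute[OF disj] by metis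
    then show "chi_critical t (dirac_join t G2 G1)" "chi t (dirac_join t G2 G1) = chi t G2 + chi t G1"
      using crit chi by simp_all
  qed (use disj in blast)
  ultimately show ?thesis using A(2,3) G chi by (intro that[OF _ _ disj]) (simp_all only: V not_False_eq_True)
qed

section \<open>Counting missing edges\<close>

definition edge_defect :: "nat \<Rightarrow> 'a mgraph \<Rightarrow> int" where
  "edge_defect t G =
    int t * int (card (verts G)) * (int (card (verts G)) - 1) - 2 * int (num_edges G)"

definition excess :: "nat \<Rightarrow> 'a mgraph \<Rightarrow> int" where
  "excess t G = int (card (verts G)) - int (chi t G)"

text \<open>The defect is twice the shortfall from the complete graph with \<open>t\<close>-fold
  edges, and pairs across the join have no shortfall.\<close>

lemma edge_defect_dirac_join:
  assumes "multigraph G1" "multigraph G2" "verts G1 \<inter> verts G2 = {}"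
  shows "edge_defect t (dirac_join t G1 G2) = edge_defect t G1 + edge_defect t G2"
  using assms
  by (simp add: edge_defect_def num_edges_dirac_join card_Un_disjoint multigraph_def algebra_simps)

text \<open>Summing the degree bound t(k - 1) over all n vertices leaves a defect of at most tn(n -
  k).\<close>

lemma edge_defect_large_order:
  assumes t: "t \<ge> 1" and crit: "chi_critical t G" and ne: "verts G \<noteq> {}"
    and large: "2 * chi t G \<le> card (verts G) + 1"
  shows "edge_defect t G \<le> int t * (2 * (excess t G)\<^sup>2 + excess t G)"
proof -
  have mg: "multigraph G" using crit by (simp add: chi_critical_def)
  define n k where "n = int (card (verts G))" and "k = int (chi t G)"
  have k: "1 \<le> k" using chi_pos[OF t mg ne] by (simp add: k_def)
  have n: "2 * k \<le> n + 1" using large by (simp add: n_def k_def)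
  have "card (verts G) * (t * (chi t G - 1)) \<le> 2 * num_edges G"
    using sum_mono[of "verts G" "\<lambda>_. t * (chi t G - 1)" "degree G"] chi_critical_degree[OF t crit]
      sum_degree[OF mg] by simp
  then have "int (card (verts G) * (t * (chi t G - 1))) \<le> int (2 * num_edges G)"
    by (simp only: of_nat_le_iff)
  moreover have "int (chi t G - 1) = k - 1" using k by (simp add: k_def)
  ultimately have "n * (int t * (k - 1)) \<le> 2 * int (num_edges G)"
    unfolding of_nat_mult n_def by simp
  then have "edge_defect t G \<le> int t * (n * (n - k))"
    by (simp add: edge_defect_def n_def[symmetric] algebra_simps)
  \<comment> \<open>The bound 2k \<le> n + 1 is the same as n \<le> 2(n - k) + 1.\<close>
  also have "n * (n - k) \<le> (2 * (n - k) + 1) * (n - k)"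
    using n k by (intro mult_right_mono) auto
  then have "int t * (n * (n - k)) \<le> int t * (2 * (n - k)\<^sup>2 + (n - k))"
    by (intro mult_left_mono) (simp_all add: power2_eq_square algebra_simps)
  finally show ?thesis by (simp add: excess_def n_def k_def)
qed

text \<open>The three claims are proved together by induction on the order. Parts of a join can be
  of large or small order, so the induction uses the weaker bound for them; positive excess of both
  parts then yields the sharper bound.\<close>

lemma edge_defect_le:
  assumes t: "t \<ge> 1" and crit: "chi_critical t G" and chi: "3 \<le> chi t G" and ne: "verts G \<noteq> {}"
    and dom: "\<not> (\<exists>H \<in> Cri t 1 \<union> Cri t 2. t_dominating t H G)"
  shows "1 \<le> excess t G"
    and "edge_defect t G \<le> int t * (2 * (excess t G)\<^sup>2 + excess t G)"
    and "card (verts G) + 2 \<le> 2 * chi t G \<Longrightarrow> edge_defect t G \<le> int t * (2 * (excess t G)\<^sup>2)"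
proof -
  have "1 \<le> excess t G \<and> edge_defect t G \<le> int t * (2 * (excess t G)\<^sup>2 + excess t G) \<and>
      (card (verts G) + 2 \<le> 2 * chi t G \<longrightarrow> edge_defect t G \<le> int t * (2 * (excess t G)\<^sup>2))"
    using crit chi ne dom
  proof (induction "card (verts G)" arbitrary: G rule: less_induct)
    case (less G)
    note crit = less.prems(1)
    show ?case
    proof (cases "card (verts G) + 2 \<le> 2 * chi t G")
      \<comment> \<open>Here n \<ge> 2k - 1 and k \<ge> 3, so the excess is at least k - 1.\<close>
      case False
      then show ?thesis
        using edge_defect_large_order[OF t crit] less.prems by (simp add: excess_def)
    next
      case True
      obtain G1 G2 where D: "verts G1 \<noteq> {}" "verts G2 \<noteq> {}" "verts G1 \<inter> verts G2 = {}"
          "chi_critical t G1" "chi_critical t G2"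
          "G = dirac_join t G1 G2" "chi t G = chi t G1 + chi t G2"
        by (rule chi_critical_decomposition[OF t crit less.prems(3) True])
      have mg: "multigraph G1" "multigraph G2" using D(4,5) by (simp_all add: chi_critical_def)
      \<comment> \<open>A part dominates \<open>G\<close>, so it is in neither forbidden class and
        needs at least three colors; what dominates the part dominates \<open>G\<close> too.\<close>
      have part: "1 \<le> excess t K \<and> edge_defect t K \<le> int t * (2 * (excess t K)\<^sup>2 + excess t K)"
        if K: "verts K \<noteq> {}" "verts K' \<noteq> {}" "verts K \<inter> verts K' = {}" "chi_critical t K"
          "chi_critical t K'" "G = dirac_join t K K'" for K K'
      proof -
        have mgK: "multigraph K" "multigraph K'" using K(4,5) by (simp_all add: chi_critical_def)
        have "subgraph K G" "subgraph K' G"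
          unfolding K(6) by (intro subgraph_dirac_join1 subgraph_dirac_join2 mgK)+
        then have domK: "t_dominating t K G" using K unfolding t_dominating_def by (intro conjI exI[of _ K'])
        have noK: "\<not> (\<exists>H \<in> Cri t 1 \<union> Cri t 2. t_dominating t H K)"
          using less.prems(4) t_dominating_trans[OF _ domK] by blast
        have "K \<notin> Cri t 1 \<union> Cri t 2" using domK less.prems(4) by blast
        then have "3 \<le> chi t K" using K(4) chi_pos[OF t mgK(1) K(1)] by (auto simp: Cri_def)
        moreover have "card (verts K) < card (verts G)"
          using K(2,3) mgK by (auto simp: K(6) multigraph_def intro!: psubset_card_mono)
        ultimately show ?thesis using less.hyps[of K] K(1,4) noK by blast
      qed
      let ?p = "excess t G1" and ?q = "excess t G2"
      have p: "1 \<le> ?p" "edge_defect t G1 \<le> int t * (2 * ?p\<^sup>2 + ?p)"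
        using part[of G1 G2] D by auto
      have q: "1 \<le> ?q" "edge_defect t G2 \<le> int t * (2 * ?q\<^sup>2 + ?q)"
        using part[of G2 G1] D dirac_join_commute[OF D(3), of t] by auto
      have ex: "excess t G = ?p + ?q"
        using D(3,6,7) mg by (simp add: excess_def card_Un_disjoint multigraph_def)
      \<comment> \<open>Writing p and q for the two excesses, the cross term 4pq of the square
        absorbs the linear terms p + q.\<close>
      have "?p \<le> ?p * ?q" "?q \<le> ?p * ?q" using p(1) q(1) by simp_all
      moreover have "2 * (?p + ?q)\<^sup>2 = 2 * ?p\<^sup>2 + 2 * ?q\<^sup>2 + 4 * (?p * ?q)"
        by (simp add: power2_eq_square algebra_simps)
      ultimately have "(2 * ?p\<^sup>2 + ?p) + (2 * ?q\<^sup>2 + ?q) \<le> 2 * (?p + ?q)\<^sup>2"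
        using p(1) q(1) by linarith
      then have "int t * ((2 * ?p\<^sup>2 + ?p) + (2 * ?q\<^sup>2 + ?q)) \<le> int t * (2 * (?p + ?q)\<^sup>2)"
        by (intro mult_left_mono) auto
      then have le: "edge_defect t G \<le> int t * (2 * (excess t G)\<^sup>2)"
        using p(2) q(2) edge_defect_dirac_join[OF mg D(3), of t]
        unfolding ex D(6)[symmetric] by (simp add: distrib_left)
      have "0 \<le> int t * excess t G" using p q ex by simp
      then have "edge_defect t G \<le> int t * (2 * (excess t G)\<^sup>2 + excess t G)"
        using le by (simp add: distrib_left)
      then show ?thesis using le p q ex by simp
    qed
  qed
  then show "1 \<le> excess t G" "edge_defect t G \<le> int t * (2 * (excess t G)\<^sup>2 + excess t G)"
    "card (verts G) + 2 \<le> 2 * chi t G \<Longrightarrow> edge_defect t G \<le> int t * (2 * (excess t G)\<^sup>2)" by auto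
qed

theorem theorem26:
  fixes t k n p :: nat and G :: "'a mgraph"
  assumes "t \<ge> 1"
    and "n = k + p"
    and "2 \<le> p"
    and "p + 2 \<le> k"
    and "G \<in> Cri_order t k n"
    and "\<not> (\<exists>H \<in> Cri t 1 \<union> Cri t 2. t_dominating t H G)"
  shows "int (num_edges G) \<ge> int t * int (n choose 2) - int t * (int p)^2"
proof -
  have G: "chi_critical t G" "chi t G = k" "card (verts G) = n"
    using assms(5) by (auto simp: Cri_order_def Cri_def)
  then have "verts G \<noteq> {}" using assms(2,4) by auto
  then have "edge_defect t G \<le> int t * (2 * (excess t G)\<^sup>2)"
    \<comment> \<open>With n = k + p, the assumption p + 2 \<le> k reads n + 2 \<le> 2k, the range
      of the sharper bound.\<close>
    using assms G by (intro edge_defect_le) auto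
  moreover have "excess t G = int p" using G assms(2) by (simp add: excess_def)
  moreover have "int n * (int n - 1) = 2 * int (n choose 2)"
  proof -
    have "even (n * (n - 1))" by (cases n) auto
    then have "2 * (n choose 2) = n * (n - 1)" by (simp add: choose_two)
    then have "int (2 * (n choose 2)) = int (n * (n - 1))" by (rule arg_cong)
    then show ?thesis using assms(2,4) by (simp add: of_nat_diff)
  qed
  \<comment> \<open>Since the defect counts missing edges twice, the bound 2tp^2 is halved.\<close>
  ultimately show ?thesis using G(3) by (simp add: edge_defect_def mult.assoc)
qed

end
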